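(* For every integer $m\ge 1$, the set $\mathcal R_m=\{t\in\mathbb C : P_m(t)=0\}$ of all complex roots of the polynomial $P_m$ is $$\mathcal R_m=\Big\{1,\ \Big(\frac{5}{3}\Big)^2,\ \Big(\frac{7}{3}\Big)^2,\ \dots,\ \Big(\frac{2m+3}{3}\Big)^2\Big\}=\Big\{\Big(\frac{2j+1}{3}\Big)^2 : 1\le j\le m+1\Big\}.$$
   Context: Fix an integer $m\ge 1$. For a number $b_0$ and $a_0=1$, consider the equations $$2j\,a_j-(2m+5-2j)\,a_{j-1}=-3b_0b_{j-1}\quad(1\le j\le m),$$ $$(2k+3)\,b_k-(2m+2-2k)\,b_{k-1}=3b_0a_k\quad(1\le k\le m),$$ $$a_m=b_0b_m .$$ The first $2m$ of these determine $a_1,b_1,a_2,b_2,\dots,a_m,b_m$ successively in terms of $b_0$, in the form $a_j=p_j(b_0^2)$ and $b_k=b_0\,q_k(b_0^2)$, where $p_j,q_k$ are polynomials (depending on $m$) given by $p_0=q_0=1$ and, for $1\le j\le m$, $$2j\,p_j(t)=(2m+5-2j)\,p_{j-1}(t)-3t\,q_{j-1}(t),\qquad (2j+3)\,q_j(t)=(2m+2-2j)\,q_{j-1}(t)+3\,p_j(t).$$ The polynomial $P_m$ is $P_m(t)=t\,q_m(t)-p_m(t)$, so that $b_0b_m-a_m=P_m(b_0^2)$ and the last equation $a_m=b_0b_m$ reads $P_m(b_0^2)=0$. *)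

theory Defs
  imports Complex_Main "HOL-Computational_Algebra.Polynomial"
begin

text \<open>
  The sequences satisfy, for \<open>1 \<le> j \<le> m\<close>,
  \<open>2 j p\<^sub>j(t) = (2 m + 5 - 2 j) p\<^sub>j\<^sub>-\<^sub>1(t) - 3 t q\<^sub>j\<^sub>-\<^sub>1(t)\<close> and
  \<open>(2 j + 3) q\<^sub>j(t) = (2 m + 2 - 2 j) q\<^sub>j\<^sub>-\<^sub>1(t) + 3 p\<^sub>j(t)\<close>.
  The definition divides by the leading factors. The coefficients are computed in the
  complex numbers, so no subtraction truncates; the values at indices above \<open>m\<close> are
  not used.
\<close>

function p_poly :: "nat \<Rightarrow> nat \<Rightarrow> complex poly"
  and q_poly :: "nat \<Rightarrow> nat \<Rightarrow> complex poly" where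
  "p_poly m 0 = 1"
| "p_poly m (Suc i) =
     smult (1 / (2 * of_nat (Suc i)))
       (smult (2 * of_nat m + 5 - 2 * of_nat (Suc i)) (p_poly m i) - [:0, 3:] * q_poly m i)"
| "q_poly m 0 = 1"
| "q_poly m (Suc i) =
     smult (1 / (2 * of_nat (Suc i) + 3))
       (smult (2 * of_nat m + 2 - 2 * of_nat (Suc i)) (q_poly m i) + smult 3 (p_poly m (Suc i)))"
  by pat_completeness auto
termination
  by (relation "measure (case_sum (\<lambda>(m, i). 2 * i) (\<lambda>(m, i). 2 * i + 1))") auto

definition P_poly :: "nat \<Rightarrow> complex poly" where
  "P_poly m = [:0, 1:] * q_poly m m - p_poly m m"

lemma p_poly_recurrence:
  assumes "1 \<le> j"
  shows "2 * of_nat j * poly (p_poly m j) t =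
    (2 * of_nat m + 5 - 2 * of_nat j) * poly (p_poly m (j - 1)) t
      - 3 * t * poly (q_poly m (j - 1)) t"
proof -
  obtain i where j: "j = Suc i"
    using assms by (cases j) auto
  have "(2 * of_nat (Suc i) :: complex) \<noteq> 0"
    by (simp del: of_nat_Suc)
  then show ?thesis
    by (simp add: j algebra_simps del: of_nat_Suc)
qed

lemma q_poly_recurrence:
  assumes "1 \<le> j"
  shows "(2 * of_nat j + 3) * poly (q_poly m j) t =
    (2 * of_nat m + 2 - 2 * of_nat j) * poly (q_poly m (j - 1)) t
      + 3 * poly (p_poly m j) t"
proof -
  obtain i where j: "j = Suc i"
    using assms by (cases j) auto
  have "(2 * of_nat (Suc i) + 3 :: complex) = of_nat (2 * Suc i + 3)"
    by simp
  then have nz: "(2 * of_nat (Suc i) + 3 :: complex) \<noteq> 0"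
    by (simp only: of_nat_eq_0_iff)
  have "poly (q_poly m j) t = ((2 * of_nat m + 2 - 2 * of_nat j) * poly (q_poly m (j - 1)) t
      + 3 * poly (p_poly m j) t) / (2 * of_nat j + 3)"
    by (simp add: j del: of_nat_Suc p_poly.simps)
  then show ?thesis
    using nz by (simp add: j del: of_nat_Suc p_poly.simps q_poly.simps)
qed

end

theory Submission
  imports Defs
begin

text \<open>
  Continuing the recurrences one step beyond \<open>m\<close> gives \<open>P\<^sub>m = -(2 m + 2) p\<^sub>m\<^sub>+\<^sub>1 / 3\<close>. Changing \<open>m\<close>
  to \<open>m + 1\<close> multiplies the generating functions of \<open>(p\<^sub>j)\<close> and \<open>(q\<^sub>j)\<close> by \<open>1 + x\<close>, which is a
  Pascal rule. Since \<open>q\<^sub>m\<^sub>+\<^sub>1\<close> and \<open>p\<^sub>m\<^sub>+\<^sub>2\<close> are multiples of \<open>p\<^sub>m\<^sub>+\<^sub>1\<close>, this rule shows that passing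
  from \<open>m\<close> to \<open>m + 1\<close> multiplies \<open>P\<^sub>m\<close> by a constant times \<open>(2 m + 5)\<^sup>2 - 9 t\<close>.
\<close>

lemma p_poly_step:
  "(2 * of_nat j + 2) * poly (p_poly m (Suc j)) t =
    (2 * of_nat m + 3 - 2 * of_nat j) * poly (p_poly m j) t - 3 * t * poly (q_poly m j) t"
  using p_poly_recurrence[of "Suc j" m t] by (simp add: algebra_simps del: p_poly.simps)

lemma q_poly_step:
  "(2 * of_nat j + 5) * poly (q_poly m (Suc j)) t =
    (2 * of_nat m - 2 * of_nat j) * poly (q_poly m j) t + 3 * poly (p_poly m (Suc j)) t"
  using q_poly_recurrence[of "Suc j" m t]
  by (simp add: algebra_simps del: p_poly.simps q_poly.simps)

lemma two_mult_of_nat_plus_numeral_neq_0: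
  "2 * of_nat j + numeral k \<noteq> (0 :: complex)"
proof -
  have "2 * of_nat j + numeral k = (of_nat (2 * j + numeral k) :: complex)"
    by simp
  then show ?thesis
    by (simp only: of_nat_eq_0_iff) simp
qed

lemma p_q_poly_pascal:
  "poly (p_poly (Suc m) (Suc j)) t = poly (p_poly m (Suc j)) t + poly (p_poly m j) t \<and>
   poly (q_poly (Suc m) (Suc j)) t = poly (q_poly m (Suc j)) t + poly (q_poly m j) t"
proof (induction j)
  case 0
  show ?case
    using p_poly_step[of 0 m t] p_poly_step[of 0 "Suc m" t]
      q_poly_step[of 0 m t] q_poly_step[of 0 "Suc m" t]
    by (simp add: field_simps del: p_poly.simps(2) q_poly.simps(2)) algebra
next
  case (Suc j)
  let ?p = "\<lambda>i. poly (p_poly m i) t" and ?q = "\<lambda>i. poly (q_poly m i) t"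
  let ?p' = "\<lambda>i. poly (p_poly (Suc m) i) t" and ?q' = "\<lambda>i. poly (q_poly (Suc m) i) t"
  let ?M = "of_nat m :: complex" and ?J = "of_nat j :: complex"
  have IH: "?p' (Suc j) = ?p (Suc j) + ?p j" "?q' (Suc j) = ?q (Suc j) + ?q j"
    using Suc.IH by auto
  \<comment> \<open>The coefficient \<open>2m+3-2j\<close> depends only on \<open>m-j\<close>, so
    adding the recurrences for \<open>m\<close> at \<open>j\<close> and \<open>j+1\<close> gives the
    one for \<open>m+1\<close> at \<open>j+1\<close>; the surplus \<open>2 p_(j+1)\<close> raises
    \<open>2j+2\<close> to \<open>2j+4\<close>. The same happens for \<open>q\<close>.\<close>
  have "(2 * ?J + 4) * ?p' (Suc (Suc j)) = (2 * ?J + 4) * (?p (Suc (Suc j)) + ?p (Suc j))"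
    using p_poly_step[of j m t] p_poly_step[of "Suc j" m t] p_poly_step[of "Suc j" "Suc m" t]
    unfolding IH of_nat_Suc by algebra
  then have p: "?p' (Suc (Suc j)) = ?p (Suc (Suc j)) + ?p (Suc j)"
    using two_mult_of_nat_plus_numeral_neq_0 mult_cancel_left by blast
  have "(2 * ?J + 7) * ?q' (Suc (Suc j)) = (2 * ?J + 7) * (?q (Suc (Suc j)) + ?q (Suc j))"
    using q_poly_step[of j m t] q_poly_step[of "Suc j" m t] q_poly_step[of "Suc j" "Suc m" t]
    unfolding IH p of_nat_Suc by algebra
  then have "?q' (Suc (Suc j)) = ?q (Suc (Suc j)) + ?q (Suc j)"
    using two_mult_of_nat_plus_numeral_neq_0 mult_cancel_left by blast
  with p show ?case
    by blast
qed

text \<open>At index \<open>m\<close> the \<open>q_m\<close> term vanishes, leaving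
  \<open>(2m+5) q_(m+1) = 3 p_(m+1)\<close>, hence
  \<open>(2m+5)(2m+4) p_(m+2) = (2m+5-9t) p_(m+1)\<close>. The Pascal rule adds
  \<open>(2m+5)(2m+4) p_(m+1)\<close>, completing the square.\<close>

lemma p_poly_Suc_Suc:
  "(2 * of_nat m + 5) * (2 * of_nat m + 4) * poly (p_poly (Suc m) (Suc (Suc m))) t =
    ((2 * of_nat m + 5)\<^sup>2 - 9 * t) * poly (p_poly m (Suc m)) t"
proof -
  have "poly (p_poly (Suc m) (Suc (Suc m))) t =
      poly (p_poly m (Suc (Suc m))) t + poly (p_poly m (Suc m)) t"
    using p_q_poly_pascal by blast
  then show ?thesis
    using p_poly_step[of "Suc m" m t] q_poly_step[of m m t]
    unfolding of_nat_Suc by algebra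
qed

lemma poly_p_poly_Suc_eq_0_iff:
  "poly (p_poly m (Suc m)) t = 0 \<longleftrightarrow> (\<exists>j\<in>{1..m + 1}. t = ((2 * of_nat j + 1) / 3)\<^sup>2)"
proof (induction m)
  case 0
  \<comment> \<open>Here \<open>2 p_1 = 3 - 3t\<close>, with the single root 1, the entry
    \<open>j = 1\<close>.\<close>
  show ?case
    using p_poly_step[of 0 0 t] by (auto simp del: p_poly.simps(2))
next
  case (Suc m)
  have "poly (p_poly (Suc m) (Suc (Suc m))) t = 0 \<longleftrightarrow>
      (2 * of_nat m + 5)\<^sup>2 - 9 * t = 0 \<or> poly (p_poly m (Suc m)) t = 0"
    using p_poly_Suc_Suc[of m t] two_mult_of_nat_plus_numeral_neq_0[of m]
    by (metis mult_eq_0_iff)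
  moreover have "(2 * of_nat m + 5)\<^sup>2 - 9 * t = 0 \<longleftrightarrow> t = ((2 * of_nat (m + 2) + 1) / 3)\<^sup>2"
    by (auto simp: power_divide field_simps)
  moreover have "{1..Suc m + 1} = insert (m + 2) {1..m + 1}"
    by auto
  ultimately show ?case
    using Suc.IH by simp
qed

text \<open>At \<open>j = m\<close> the coefficient \<open>2m+3-2j\<close> equals 3, the same
  constant as in front of \<open>t q_m\<close>.\<close>

lemma poly_P_poly_eq_0_iff: "poly (P_poly m) t = 0 \<longleftrightarrow> poly (p_poly m (Suc m)) t = 0"
proof -
  have "(2 * of_nat m + 2) * poly (p_poly m (Suc m)) t = - 3 * poly (P_poly m) t"
    using p_poly_step[of m m t]
    by (simp add: P_poly_def algebra_simps del: p_poly.simps q_poly.simps)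
  then show ?thesis
    using two_mult_of_nat_plus_numeral_neq_0[of m] by (metis mult_eq_0_iff neg_equal_0_iff_equal zero_neq_numeral)
qed

theorem theorem4p2:
  fixes m :: nat
  assumes "m \<ge> 1"
  shows "{t :: complex. poly (P_poly m) t = 0} =
    {((2 * of_nat j + 1) / 3)\<^sup>2 | j :: nat. 1 \<le> j \<and> j \<le> m + 1}"
  unfolding poly_P_poly_eq_0_iff poly_p_poly_Suc_eq_0_iff by auto

end
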